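(* Let $G=(V,E)$ be a finite simple graph. If $G$ is bipartite, then $\mathrm{rk}_H(G,w)\le 2$ for any node weights $w\in\mathbb{R}^V_+$ and any edge weights satisfying $w_{ij}\ge\min\{w_i,w_j\}$ for all edges $ij\in E$.
   Context: Let $V=[n]$. $\alpha(G,w)$ is the maximum of $w(S)=\sum_{i\in S}w_i$ over stable sets $S$ of $G$. For $I\subseteq V$ write $x^I=\prod_{i\in I}x_i$ and $(1-x)^I=\prod_{i\in I}(1-x_i)$. For an integer $t\ge 1$, $$H_t=\Big\{\sum_{T\subseteq V,\ |T|\le t}\ \sum_{I\subseteq T}c_{T,I}\,x^I(1-x)^{T\setminus I}:\ c_{T,I}\ge 0\Big\}\subseteq\mathbb{R}[x_1,\dots,x_n].$$ Set $p_{G,w}=\sum_{i\in V}w_ix_i-\sum_{ij\in E}w_{ij}x_ix_j$ and $p_{\mathrm{han}}^{(t)}(G,w)=\inf\{\lambda\in\mathbb{R}:\lambda-p_{G,w}\in H_t\}$. The Handelman rank $\mathrm{rk}_H(G,w)$ is the smallest integer $t\ge1$ for which $p_{\mathrm{han}}^{(t)}(G,w)=\alpha(G,w)$; equivalently, the smallest $t$ for which $\alpha(G,w)-p_{G,w}\in H_t$. *)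

theory Defs
  imports Complex_Main "HOL-Library.Poly_Mapping" "HOL-Library.Ramsey"
    "HOL-Library.Extended_Real" "HOL-Library.Extended_Nat"
begin

section \<open>Graphs and weighted stable sets\<close>

definition finite_simple_graph :: "'a set \<Rightarrow> 'a set set \<Rightarrow> bool" where
  "finite_simple_graph V E \<longleftrightarrow> finite V \<and> E \<subseteq> [V]\<^bsup>2\<^esup>"

definition bipartite_graph :: "'a set \<Rightarrow> 'a set set \<Rightarrow> bool" where
  "bipartite_graph V E \<longleftrightarrow>
    (\<exists>A B. A \<union> B = V \<and> A \<inter> B = {} \<and> (\<forall>e\<in>E. \<exists>a\<in>A. \<exists>b\<in>B. e = {a, b}))"

definition weighted_stability_number :: "'a set \<Rightarrow> 'a set set \<Rightarrow> ('a \<Rightarrow> real) \<Rightarrow> real" where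
  "weighted_stability_number V E w = Max {\<Sum>i\<in>S. w i |S. S \<subseteq> V \<and> indep S E}"


section \<open>Real polynomials in variables indexed by a type\<close>

text \<open>A polynomial maps each monomial (an exponent vector of finite support) to its coefficient;
  the ring structure on \<^typ>\<open>('a \<Rightarrow>\<^sub>0 nat) \<Rightarrow>\<^sub>0 real\<close> is the convolution product, so this is
  the usual polynomial ring, not a ring of functions. Variables outside the vertex set
  do not occur in the polynomials below.\<close>

type_synonym 'a real_mpoly = "('a \<Rightarrow>\<^sub>0 nat) \<Rightarrow>\<^sub>0 real"

definition mconst :: "real \<Rightarrow> 'a real_mpoly" where
  "mconst c = Poly_Mapping.single 0 c"

definition mvar :: "'a \<Rightarrow> 'a real_mpoly" where
  "mvar i = Poly_Mapping.single (Poly_Mapping.single i 1) 1"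


section \<open>The Handelman hierarchy\<close>

definition handelman_set :: "'a set \<Rightarrow> nat \<Rightarrow> 'a real_mpoly set" where
  "handelman_set V t =
    {\<Sum>T\<in>{T. T \<subseteq> V \<and> card T \<le> t}. \<Sum>I\<in>Pow T.
        mconst (c T I) * ((\<Prod>i\<in>I. mvar i) * (\<Prod>i\<in>T - I. 1 - mvar i))
     |c. \<forall>T I. T \<subseteq> V \<and> card T \<le> t \<and> I \<subseteq> T \<longrightarrow> c T I \<ge> 0}"

text \<open>In the rest of this section, \<^term>\<open>w\<close> gives the node weights and \<^term>\<open>u\<close> the edge weights.\<close>

definition stable_set_poly ::
    "'a set \<Rightarrow> 'a set set \<Rightarrow> ('a \<Rightarrow> real) \<Rightarrow> ('a set \<Rightarrow> real) \<Rightarrow> 'a real_mpoly" where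
  "stable_set_poly V E w u =
    (\<Sum>i\<in>V. mconst (w i) * mvar i) - (\<Sum>e\<in>E. mconst (u e) * (\<Prod>i\<in>e. mvar i))"

text \<open>The infimum is taken in the extended reals, since no feasible \<^term>\<open>l\<close> need exist for small
  \<^term>\<open>t\<close>; the bound is then \<^term>\<open>\<infinity> :: ereal\<close>.\<close>

definition handelman_bound ::
    "nat \<Rightarrow> 'a set \<Rightarrow> 'a set set \<Rightarrow> ('a \<Rightarrow> real) \<Rightarrow> ('a set \<Rightarrow> real) \<Rightarrow> ereal" where
  "handelman_bound t V E w u =
    Inf (ereal ` {l. mconst l - stable_set_poly V E w u \<in> handelman_set V t})"

text \<open>The rank is \<^term>\<open>\<infinity> :: enat\<close> if no level is exact; otherwise the infimum is the minimum.\<close>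

definition handelman_rank ::
    "'a set \<Rightarrow> 'a set set \<Rightarrow> ('a \<Rightarrow> real) \<Rightarrow> ('a set \<Rightarrow> real) \<Rightarrow> enat" where
  "handelman_rank V E w u =
    Inf {enat t |t. t \<ge> 1 \<and>
      handelman_bound t V E w u = ereal (weighted_stability_number V E w)}"

end

theory Submission
  imports Defs
begin

text \<open>Evaluating at the indicator vector of a maximum weight stable set shows that no level of the
  hierarchy goes below the stability number. Conversely, let \<open>y\<close> be a fractional edge packing with
  \<open>y(\<delta>(i)) \<le> w\<^sub>i\<close> whose value is the weight of some vertex cover, as provided by the
  weighted Koenig theorem, and let \<open>z\<^sub>i = w\<^sub>i - y(\<delta>(i)) \<ge> 0\<close>. Then
  \<open>w(V) - y(E) - p = \<Sum>\<^sub>i z\<^sub>i (1 - x\<^sub>i) + \<Sum>\<^sub>i\<^sub>j y\<^sub>i\<^sub>j (1 - x\<^sub>i)(1 - x\<^sub>j)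
    + \<Sum>\<^sub>i\<^sub>j (u\<^sub>i\<^sub>j - y\<^sub>i\<^sub>j) x\<^sub>i x\<^sub>j\<close>,
  whose coefficients are nonnegative because \<open>y\<^sub>i\<^sub>j \<le> min w\<^sub>i w\<^sub>j\<close>.\<close>

section \<open>The weighted Koenig theorem\<close>

definition vertex_cover :: "'a set \<Rightarrow> 'a set set \<Rightarrow> 'a set \<Rightarrow> bool" where
  "vertex_cover V E C \<longleftrightarrow> C \<subseteq> V \<and> (\<forall>e\<in>E. e \<inter> C \<noteq> {})"

text \<open>Take an edge with ends \<open>p\<close> in \<open>A\<close> and \<open>q\<close> in
  \<open>B\<close>. If \<open>p\<close> is in neither \<open>C\<close> nor \<open>D\<close>, then
  \<open>q\<close> is in both, so the first set meets the edge; the second is symmetric. The edge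
  \<open>{a, b}\<close>, which \<open>D\<close> may miss, is met at \<open>a\<close> by the first
  set and at \<open>b\<close> by the second, because \<open>C\<close> contains both ends.\<close>

lemma vertex_cover_uncross:
  assumes "A \<inter> B = {}" and "a \<in> A" "b \<in> B"
    and bip: "\<And>e. e \<in> E \<Longrightarrow> \<exists>a\<in>A. \<exists>b\<in>B. e = {a, b}"
    and C: "vertex_cover (A \<union> B) (insert {a, b} E) C" "a \<in> C" "b \<in> C"
    and D: "vertex_cover (A \<union> B) E D"
  shows "vertex_cover (A \<union> B) (insert {a, b} E) (A \<inter> (C \<union> D) \<union> B \<inter> (C \<inter> D))"
    and "vertex_cover (A \<union> B) (insert {a, b} E) (A \<inter> (C \<inter> D) \<union> B \<inter> (C \<union> D))"
proof -
  have *: "e \<inter> (A \<inter> (C \<union> D) \<union> B \<inter> (C \<inter> D)) \<noteq> {} \<and> e \<inter> (A \<inter> (C \<inter> D) \<union> B \<inter> (C \<union> D)) \<noteq> {}"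
    if "e \<in> E" for e
  proof -
    obtain p q where "p \<in> A" "q \<in> B" "e = {p, q}"
      using bip[OF \<open>e \<in> E\<close>] by blast
    moreover have "e \<inter> C \<noteq> {}" "e \<inter> D \<noteq> {}"
      using C(1) D that by (auto simp: vertex_cover_def)
    ultimately show ?thesis
      by auto
  qed
  show "vertex_cover (A \<union> B) (insert {a, b} E) (A \<inter> (C \<union> D) \<union> B \<inter> (C \<inter> D))"
    using * assms(2,3) C(2,3) by (auto simp: vertex_cover_def)
  show "vertex_cover (A \<union> B) (insert {a, b} E) (A \<inter> (C \<inter> D) \<union> B \<inter> (C \<union> D))"
    using * assms(2,3) C(2,3) by (auto simp: vertex_cover_def)
qed

text \<open>On each side of the bipartition one set carries the union and the other the intersection
  of \<open>C\<close> and \<open>D\<close>, and sums are modular.\<close>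

lemma sum_uncross:
  fixes w :: "'a \<Rightarrow> real"
  assumes "finite A" "finite B" "A \<inter> B = {}" "C \<subseteq> A \<union> B" "D \<subseteq> A \<union> B"
  shows "sum w (A \<inter> (C \<union> D) \<union> B \<inter> (C \<inter> D)) + sum w (A \<inter> (C \<inter> D) \<union> B \<inter> (C \<union> D))
    = sum w C + sum w D"
proof -
  have split: "sum w (A \<inter> X \<union> B \<inter> Y) = sum w (A \<inter> X) + sum w (B \<inter> Y)" for X Y
    using assms(1-3) by (intro sum.union_disjoint) auto
  have un: "sum w (F \<inter> (C \<union> D)) + sum w (F \<inter> (C \<inter> D)) = sum w (F \<inter> C) + sum w (F \<inter> D)"
    if "finite F" for F
    using sum.union_inter[of "F \<inter> C" "F \<inter> D" w] that
    by (simp add: Int_Un_distrib Int_ac)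
  have "C = A \<inter> C \<union> B \<inter> C" "D = A \<inter> D \<union> B \<inter> D"
    using assms(4,5) by auto
  then have "sum w C = sum w (A \<inter> C) + sum w (B \<inter> C)" "sum w D = sum w (A \<inter> D) + sum w (B \<inter> D)"
    using split by metis+
  then show ?thesis
    using un[of A] un[of B] assms(1,2) by (simp add: split)
qed

text \<open>Induction on the edges, for all weights at once: the new edge \<open>f\<close> receives
  the packing value \<epsilon>, both its ends lose that much weight, and the induction hypothesis
  packs \<open>E\<close> within the reduced weights.\<close>

theorem weighted_koenig:
  fixes w :: "'a \<Rightarrow> real"
  assumes "finite E" and fin: "finite A" "finite B" and dis: "A \<inter> B = {}"
    and "\<And>e. e \<in> E \<Longrightarrow> \<exists>a\<in>A. \<exists>b\<in>B. e = {a, b}"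
    and "\<And>i. i \<in> A \<union> B \<Longrightarrow> 0 \<le> w i"
  shows "\<exists>y C. (\<forall>e. 0 \<le> y e) \<and> (\<forall>i\<in>A \<union> B. (\<Sum>e\<in>{e\<in>E. i \<in> e}. y e) \<le> w i) \<and>
    vertex_cover (A \<union> B) E C \<and> sum w C \<le> sum y E"
  using assms(1,5,6)
proof (induction E arbitrary: w rule: finite_induct)
  case empty
  then show ?case
    by (intro exI[of _ "\<lambda>_. 0"] exI[of _ "{}"]) (auto simp: vertex_cover_def)
next
  case (insert f E)
  obtain a b where ab: "a \<in> A" "b \<in> B" and f: "f = {a, b}"
    using insert.prems(1)[of f] by blast
  then have "a \<noteq> b"
    using dis by auto
  define V where "V = A \<union> B"
  have "finite V"
    using fin by (simp add: V_def)
  define K where "K = {C. vertex_cover V (insert f E) C}"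
  have "finite K"
    using \<open>finite V\<close> by (auto simp: K_def vertex_cover_def intro: finite_subset[of _ "Pow V"])
  have "V \<in> K"
    using insert.prems(1) by (fastforce simp: K_def vertex_cover_def V_def)
  \<comment> \<open>This minimum weight cover is the witness \<open>C\<close> of the conclusion; the
    cover \<open>D\<close> from the induction hypothesis serves to bound its weight.\<close>
  define M where "M = arg_min_on (sum w) K"
  have M: "M \<in> K" "\<And>C. C \<in> K \<Longrightarrow> sum w M \<le> sum w C"
    unfolding M_def using \<open>finite K\<close> \<open>V \<in> K\<close>
    by (auto intro: arg_min_if_finite(1) arg_min_least)
  \<comment> \<open>The largest decrease of both weights that lowers the minimum cover weight at the same rate.\<close>
  define \<epsilon> where "\<epsilon> = Min ({w a, w b} \<union> (\<lambda>C. sum w C - sum w M) ` {C \<in> K. a \<in> C \<and> b \<in> C})"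
  have fin_eps: "finite ({w a, w b} \<union> (\<lambda>C. sum w C - sum w M) ` {C \<in> K. a \<in> C \<and> b \<in> C})"
    using \<open>finite K\<close> by simp
  then have eps_in: "\<epsilon> \<in> {w a, w b} \<union> (\<lambda>C. sum w C - sum w M) ` {C \<in> K. a \<in> C \<and> b \<in> C}"
    unfolding \<epsilon>_def by (rule Min_in) simp
  have eps_le: "\<epsilon> \<le> w a" "\<epsilon> \<le> w b" "\<And>C. C \<in> K \<Longrightarrow> a \<in> C \<Longrightarrow> b \<in> C \<Longrightarrow> \<epsilon> \<le> sum w C - sum w M"
    unfolding \<epsilon>_def by (rule Min_le[OF fin_eps]; blast)+
  have "0 \<le> \<epsilon>"
    using eps_in M(2) insert.prems(2) ab by auto
  define w' where "w' i = w i - (if i \<in> f then \<epsilon> else 0)" for i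
  have "\<exists>y C. (\<forall>e. 0 \<le> y e) \<and> (\<forall>i\<in>A \<union> B. (\<Sum>e\<in>{e\<in>E. i \<in> e}. y e) \<le> w' i) \<and>
    vertex_cover (A \<union> B) E C \<and> sum w' C \<le> sum y E"
    using insert.prems eps_le by (intro insert.IH) (auto simp: w'_def f)
  then obtain y D where y: "\<And>e. 0 \<le> y e" "\<And>i. i \<in> V \<Longrightarrow> (\<Sum>e\<in>{e\<in>E. i \<in> e}. y e) \<le> w' i"
    and D: "vertex_cover V E D" "sum w' D \<le> sum y E"
    unfolding V_def by blast
  have "D \<subseteq> V" "finite D"
    using D(1) \<open>finite V\<close> by (auto simp: vertex_cover_def intro: finite_subset)
  have "sum w' D = sum w D - (\<Sum>i\<in>D. if i \<in> f then \<epsilon> else 0)"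
    by (simp add: w'_def sum_subtractf)
  also have "(\<Sum>i\<in>D. if i \<in> f then \<epsilon> else 0) = \<epsilon> * card (D \<inter> f)"
    using \<open>finite D\<close> by (simp add: sum.If_cases)
  finally have w'D: "sum w' D = sum w D - \<epsilon> * card (D \<inter> f)" .
  \<comment> \<open>\<open>D\<close> covers \<open>E\<close> but possibly not \<open>f\<close>. With
    one end of \<open>f\<close> in \<open>D\<close>, the weights \<open>w\<close> and
    \<open>w'\<close> of \<open>D\<close> differ by \<epsilon>. With both ends they differ by
    \<open>2 * \<epsilon>\<close>, and \<open>eps_le(3)\<close> applied to \<open>D\<close> makes up
    for the excess.\<close>
  have "sum w M \<le> sum w' D + \<epsilon>"
  proof -
    consider "a \<notin> D" "b \<notin> D" | "a \<in> D \<longleftrightarrow> b \<notin> D" | "a \<in> D" "b \<in> D"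
      by blast
    then show ?thesis
    proof cases
      case 1
      then have D': "sum w' D = sum w D"
        using w'D by (simp add: f)
      have ins: "insert i D \<in> K" if "i \<in> f" for i
        using D(1) that ab by (auto simp: K_def vertex_cover_def f V_def)
      \<comment> \<open>The term attaining the minimum pays for covering \<open>f\<close>. Adding
        \<open>a\<close> or \<open>b\<close> to \<open>D\<close> costs \<open>w a\<close> or
        \<open>w b\<close>; otherwise a cover \<open>C\<close> of weight
        \<open>sum w M + \<epsilon>\<close> through both ends is uncrossed with \<open>D\<close>
        into two members of \<open>K\<close>, each of weight at least
        \<open>sum w M\<close>.\<close>
      from eps_in consider "\<epsilon> = w a" | "\<epsilon> = w b"
        | C where "C \<in> K" "a \<in> C" "b \<in> C" "\<epsilon> = sum w C - sum w M"
        by auto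
      then show ?thesis
      proof cases
        case 1
        then show ?thesis
          using M(2)[OF ins[of a]] \<open>a \<notin> D\<close> \<open>finite D\<close> D' by (simp add: f)
      next
        case 2
        then show ?thesis
          using M(2)[OF ins[of b]] \<open>b \<notin> D\<close> \<open>finite D\<close> D' by (simp add: f)
      next
        case (3 C)
        have C: "vertex_cover (A \<union> B) (insert {a, b} E) C"
          using 3(1) by (simp add: K_def f V_def)
        note un = vertex_cover_uncross[OF dis ab _ C 3(2,3) D(1)[unfolded V_def]]
        have "A \<inter> (C \<union> D) \<union> B \<inter> (C \<inter> D) \<in> K" "A \<inter> (C \<inter> D) \<union> B \<inter> (C \<union> D) \<in> K"
          using un insert.prems(1) by (simp_all add: K_def V_def f)
        note this[THEN M(2)]
        moreover have "sum w (A \<inter> (C \<union> D) \<union> B \<inter> (C \<inter> D)) + sum w (A \<inter> (C \<inter> D) \<union> B \<inter> (C \<union> D))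
          = sum w C + sum w D"
          using C \<open>D \<subseteq> V\<close> by (intro sum_uncross fin dis) (auto simp: vertex_cover_def V_def)
        ultimately have "2 * sum w M \<le> sum w C + sum w D"
          by linarith
        then show ?thesis
          using 3(4) D' by simp
      qed
    next
      case 2
      then have "D \<in> K" "D \<inter> f = {a} \<or> D \<inter> f = {b}"
        using D(1) by (auto simp: K_def vertex_cover_def f)
      then show ?thesis
        using M(2)[of D] w'D by auto
    next
      case 3
      then have "D \<in> K" "D \<inter> f = {a, b}"
        using D(1) by (auto simp: K_def vertex_cover_def f)
      then show ?thesis
        using eps_le(3)[of D] 3 w'D \<open>a \<noteq> b\<close> by simp
    qed
  qed
  \<comment> \<open>Since \<open>f\<close> is not in \<open>E\<close>, overwriting the arbitrary
    value of \<open>y\<close> there leaves sums over \<open>E\<close> unchanged.\<close>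
  moreover have "(\<Sum>e\<in>E. (y(f := \<epsilon>)) e) = sum y E"
    using insert.hyps by (intro sum.cong) auto
  ultimately have val: "sum w M \<le> sum (y(f := \<epsilon>)) (insert f E)"
    using D(2) insert.hyps by simp
  \<comment> \<open>At the ends of \<open>f\<close>, the bound by \<open>w'\<close> leaves room for
    exactly \<epsilon>.\<close>
  have deg: "(\<Sum>e\<in>{e \<in> insert f E. i \<in> e}. (y(f := \<epsilon>)) e) \<le> w i" if "i \<in> V" for i
  proof -
    have "(\<Sum>e\<in>{e\<in>E. i \<in> e}. (y(f := \<epsilon>)) e) = (\<Sum>e\<in>{e\<in>E. i \<in> e}. y e)"
      using insert.hyps by (intro sum.cong) auto
    moreover have "{e \<in> insert f E. i \<in> e} = (if i \<in> f then insert f {e\<in>E. i \<in> e} else {e\<in>E. i \<in> e})"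
      by auto
    ultimately show ?thesis
      using y(2)[OF that] insert.hyps by (cases "i \<in> f") (simp_all add: w'_def)
  qed
  show ?case
    using val deg y(1) \<open>0 \<le> \<epsilon>\<close> M(1) unfolding V_def K_def
    by (intro exI[of _ "y(f := \<epsilon>)"] exI[of _ M]) simp
qed

section \<open>Evaluation of polynomials\<close>

text \<open>The linear extension of \<mu> from monomials to polynomials; it is a ring homomorphism
  when \<mu> turns sums of exponents into products.\<close>

definition eval_monom :: "('m \<Rightarrow> 'b) \<Rightarrow> ('m \<Rightarrow>\<^sub>0 'b) \<Rightarrow> 'b::comm_semiring_1" where
  "eval_monom \<mu> p = (\<Sum>m\<in>Poly_Mapping.keys p. Poly_Mapping.lookup p m * \<mu> m)"

lemma eval_monom_superset:
  assumes "finite K" "Poly_Mapping.keys p \<subseteq> K"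
  shows "eval_monom \<mu> p = (\<Sum>m\<in>K. Poly_Mapping.lookup p m * \<mu> m)"
  unfolding eval_monom_def using assms by (intro sum.mono_neutral_left) (auto simp: in_keys_iff)

lemma eval_monom_zero [simp]: "eval_monom \<mu> 0 = 0"
  by (simp add: eval_monom_def)

lemma eval_monom_single [simp]: "eval_monom \<mu> (Poly_Mapping.single m c) = c * \<mu> m"
  by (subst eval_monom_superset[of "{m}"]) auto

lemma eval_monom_add: "eval_monom \<mu> (p + q) = eval_monom \<mu> p + eval_monom \<mu> q"
proof -
  let ?K = "Poly_Mapping.keys p \<union> Poly_Mapping.keys q"
  have "finite ?K" by simp
  then show ?thesis
    using Poly_Mapping.keys_add[of p q]
    by (simp add: eval_monom_superset[of ?K] lookup_add distrib_right sum.distrib)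
qed

lemma eval_monom_sum: "eval_monom \<mu> (\<Sum>i\<in>A. f i) = (\<Sum>i\<in>A. eval_monom \<mu> (f i))"
  by (induction A rule: infinite_finite_induct) (simp_all add: eval_monom_add)

lemma eval_monom_diff:
  fixes p :: "'m \<Rightarrow>\<^sub>0 'b::comm_ring_1"
  shows "eval_monom \<mu> (p - q) = eval_monom \<mu> p - eval_monom \<mu> q"
  using eval_monom_add[of \<mu> "p - q" q] by simp

lemma sum_single_lookup:
  "(\<Sum>m\<in>Poly_Mapping.keys p. Poly_Mapping.single m (Poly_Mapping.lookup p m)) = p"
  by (intro poly_mapping_eqI) (auto simp: lookup_sum lookup_single when_def in_keys_iff)

locale monomial_hom =
  fixes \<mu> :: "'m::comm_monoid_add \<Rightarrow> 'b::comm_semiring_1"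
  assumes hom_zero: "\<mu> 0 = 1" and hom_add: "\<mu> (m + n) = \<mu> m * \<mu> n"
begin

text \<open>Both sides are bilinear, so splitting \<open>p\<close> and \<open>q\<close> into single
  terms reduces the claim to \<open>hom_add\<close>.\<close>

lemma eval_monom_mult: "eval_monom \<mu> (p * q) = eval_monom \<mu> p * eval_monom \<mu> q"
proof -
  let ?s = "\<lambda>r m. Poly_Mapping.single m (Poly_Mapping.lookup r m)"
  have "p * q = (\<Sum>m\<in>Poly_Mapping.keys p. ?s p m) * (\<Sum>n\<in>Poly_Mapping.keys q. ?s q n)"
    by (simp add: sum_single_lookup)
  also have "\<dots> = (\<Sum>m\<in>Poly_Mapping.keys p. \<Sum>n\<in>Poly_Mapping.keys q. ?s p m * ?s q n)"
    by (simp add: sum_product)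
  finally have "eval_monom \<mu> (p * q)
    = (\<Sum>m\<in>Poly_Mapping.keys p. \<Sum>n\<in>Poly_Mapping.keys q. eval_monom \<mu> (?s p m * ?s q n))"
    by (simp add: eval_monom_sum)
  also have "\<dots> = eval_monom \<mu> p * eval_monom \<mu> q"
    by (simp add: eval_monom_def[of _ p] eval_monom_def[of _ q] sum_product mult_single hom_add ac_simps)
  finally show ?thesis .
qed

lemma eval_monom_one [simp]: "eval_monom \<mu> 1 = 1"
  by (simp add: hom_zero flip: single_one)

lemma eval_monom_prod: "eval_monom \<mu> (\<Prod>i\<in>A. f i) = (\<Prod>i\<in>A. eval_monom \<mu> (f i))"
  by (induction A rule: infinite_finite_induct) (simp_all add: eval_monom_mult)

end

text \<open>The value of a monomial at the 0/1 indicator vector of \<open>S\<close>: it is 1 unless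
  some variable outside \<open>S\<close> occurs.\<close>

definition ind_monom :: "'a set \<Rightarrow> ('a \<Rightarrow>\<^sub>0 nat) \<Rightarrow> real" where
  "ind_monom S m = of_bool (Poly_Mapping.keys m \<subseteq> S)"

interpretation ind_monom: monomial_hom "ind_monom S" for S :: "'a set"
proof
  show "ind_monom S (m + n) = ind_monom S m * ind_monom S n" for m n
  proof -
    \<comment> \<open>Exponents are natural numbers, so nothing cancels in the sum.\<close>
    have "Poly_Mapping.keys (m + n) = Poly_Mapping.keys m \<union> Poly_Mapping.keys n"
      by (auto simp: in_keys_iff lookup_add)
    then show ?thesis
      by (auto simp: ind_monom_def)
  qed
qed (simp add: ind_monom_def)

lemma eval_mconst [simp]: "eval_monom (ind_monom S) (mconst c) = c"
  by (simp add: mconst_def ind_monom_def)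

lemma eval_mvar [simp]: "eval_monom (ind_monom S) (mvar i) = of_bool (i \<in> S)"
  by (simp add: mvar_def ind_monom_def)

text \<open>At a 0/1 point every factor \<open>mvar i\<close> and \<open>1 - mvar i\<close> takes
  the value 0 or 1.\<close>

lemma handelman_set_eval_nonneg:
  assumes "p \<in> handelman_set V t"
  shows "0 \<le> eval_monom (ind_monom S) p"
  using assms unfolding handelman_set_def
  by (auto simp: eval_monom_sum eval_monom_diff ind_monom.eval_monom_mult
      ind_monom.eval_monom_prod intro!: sum_nonneg mult_nonneg_nonneg prod_nonneg)

text \<open>Every edge has an end outside \<open>S\<close>, so all quadratic terms vanish.\<close>

lemma eval_stable_set_poly:
  assumes "finite_simple_graph V E" "S \<subseteq> V" "indep S E"
  shows "eval_monom (ind_monom S) (stable_set_poly V E w u) = sum w S"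
proof -
  have "finite V"
    using assms(1) by (simp add: finite_simple_graph_def)
  have "(\<Prod>i\<in>e. of_bool (i \<in> S)) = (0::real)" if "e \<in> E" for e
  proof -
    have "e \<in> [V]\<^bsup>2\<^esup>"
      using assms(1) that by (auto simp: finite_simple_graph_def)
    then obtain i j where "e = {i, j}" "i \<noteq> j"
      by (auto simp: nsets_2_eq)
    then show ?thesis
      using assms(3) that by (auto simp: indep_def)
  qed
  moreover have "(\<Sum>i\<in>V. w i * of_bool (i \<in> S)) = sum w S"
    using assms(2) \<open>finite V\<close> by (simp add: Int_absorb1 flip: sum.inter_restrict of_bool_def)
  ultimately show ?thesis
    by (simp add: stable_set_poly_def eval_monom_sum eval_monom_diff ind_monom.eval_monom_mult
      ind_monom.eval_monom_prod)
qed

section \<open>The Handelman cone\<close>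

lemma handelman_set_zero: "0 \<in> handelman_set V t"
  unfolding handelman_set_def by (intro CollectI exI[of _ "\<lambda>_ _. 0"]) (simp add: mconst_def)

lemma mconst_add: "mconst (a + b) = mconst a + mconst b"
  by (simp add: mconst_def single_add)

lemma mconst_diff: "mconst (a - b) = mconst a - mconst b"
  by (simp add: mconst_def single_diff)

lemma mconst_sum: "mconst (\<Sum>i\<in>A. f i) = (\<Sum>i\<in>A. mconst (f i))"
  by (induction A rule: infinite_finite_induct) (simp_all add: mconst_add, simp_all add: mconst_def)

lemma handelman_set_add:
  assumes "p \<in> handelman_set V t" "q \<in> handelman_set V t"
  shows "p + q \<in> handelman_set V t"
proof -
  obtain c d where "p = (\<Sum>T\<in>{T. T \<subseteq> V \<and> card T \<le> t}. \<Sum>I\<in>Pow T.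
        mconst (c T I) * ((\<Prod>i\<in>I. mvar i) * (\<Prod>i\<in>T - I. 1 - mvar i)))"
    "\<forall>T I. T \<subseteq> V \<and> card T \<le> t \<and> I \<subseteq> T \<longrightarrow> c T I \<ge> 0"
    "q = (\<Sum>T\<in>{T. T \<subseteq> V \<and> card T \<le> t}. \<Sum>I\<in>Pow T.
        mconst (d T I) * ((\<Prod>i\<in>I. mvar i) * (\<Prod>i\<in>T - I. 1 - mvar i)))"
    "\<forall>T I. T \<subseteq> V \<and> card T \<le> t \<and> I \<subseteq> T \<longrightarrow> d T I \<ge> 0"
    using assms unfolding handelman_set_def by blast
  then show ?thesis
    unfolding handelman_set_def
    by (intro CollectI exI[of _ "\<lambda>T I. c T I + d T I"])
      (simp add: mconst_add distrib_right sum.distrib)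
qed

lemma handelman_set_sum:
  assumes "\<And>i. i \<in> A \<Longrightarrow> f i \<in> handelman_set V t"
  shows "(\<Sum>i\<in>A. f i) \<in> handelman_set V t"
  using assms
  by (induction A rule: infinite_finite_induct) (auto simp: handelman_set_zero handelman_set_add)

text \<open>A coefficient family supported on the single pair \<open>(T, I)\<close> collapses the
  double sum. With closure under sums, certificates can then be assembled term by term.\<close>

lemma handelman_set_generator:
  assumes "finite V" "T \<subseteq> V" "card T \<le> t" "I \<subseteq> T" "0 \<le> k"
  shows "mconst k * ((\<Prod>i\<in>I. mvar i) * (\<Prod>i\<in>T - I. 1 - mvar i)) \<in> handelman_set V t"
proof -
  define g :: "'a set \<Rightarrow> 'a set \<Rightarrow> 'a real_mpoly"
    where "g T I = (\<Prod>i\<in>I. mvar i) * (\<Prod>i\<in>T - I. 1 - mvar i)" for T I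
  define c where "c T' I' = (if T' = T \<and> I' = I then k else 0)" for T' I'
  have fin: "finite {T. T \<subseteq> V \<and> card T \<le> t}" "finite (Pow T)"
    using assms(1) finite_subset[OF assms(2,1)] by simp_all
  have inner: "(\<Sum>I'\<in>Pow T'. mconst (c T' I') * g T' I') = (if T' = T then mconst k * g T I else 0)"
    for T'
  proof (cases "T' = T")
    case True
    then have "(\<Sum>I'\<in>Pow T'. mconst (c T' I') * g T' I') = (\<Sum>I'\<in>Pow T. if I' = I then mconst k * g T I else 0)"
      by (intro sum.cong) (auto simp: c_def mconst_def)
    then show ?thesis
      using True fin assms(4) by simp
  qed (simp add: c_def mconst_def)
  have "(\<Sum>T'\<in>{T. T \<subseteq> V \<and> card T \<le> t}. \<Sum>I'\<in>Pow T'. mconst (c T' I') * g T' I') = mconst k * g T I"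
    using fin assms(2,3) by (simp add: inner)
  moreover have "\<forall>T I. T \<subseteq> V \<and> card T \<le> t \<and> I \<subseteq> T \<longrightarrow> c T I \<ge> 0"
    using assms(5) by (simp add: c_def)
  ultimately show ?thesis
    unfolding handelman_set_def g_def by (intro CollectI exI[of _ c]) simp
qed

section \<open>The stability number as a lower bound for every level\<close>

lemma weighted_stability_number_ge:
  assumes "finite V" "S \<subseteq> V" "indep S E"
  shows "sum w S \<le> weighted_stability_number V E w"
proof -
  have "finite {\<Sum>i\<in>S. w i |S. S \<subseteq> V \<and> indep S E}"
    by (rule finite_subset[of _ "sum w ` Pow V"]) (use assms in auto)
  then show ?thesis
    unfolding weighted_stability_number_def using assms(2,3) by (intro Max_ge) auto
qed

lemma weighted_stability_number_attained:
  assumes "finite V"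
  obtains S where "S \<subseteq> V" "indep S E" "sum w S = weighted_stability_number V E w"
proof -
  let ?W = "{\<Sum>i\<in>S. w i |S. S \<subseteq> V \<and> indep S E}"
  have "finite ?W"
    by (rule finite_subset[of _ "sum w ` Pow V"]) (use assms in auto)
  moreover have "sum w {} \<in> ?W"
    using null_indep by blast
  then have "?W \<noteq> {}"
    by blast
  ultimately have "Max ?W \<in> ?W"
    by (rule Max_in)
  then obtain S where "Max ?W = sum w S" "S \<subseteq> V" "indep S E"
    by blast
  then show thesis
    by (intro that[of S]) (simp_all add: weighted_stability_number_def)
qed

lemma handelman_bound_ge:
  assumes "finite_simple_graph V E"
  shows "ereal (weighted_stability_number V E w) \<le> handelman_bound t V E w u"
  unfolding handelman_bound_def
proof (intro INF_greatest)
  fix l assume "l \<in> {l. mconst l - stable_set_poly V E w u \<in> handelman_set V t}"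
  moreover obtain S where "S \<subseteq> V" "indep S E" "sum w S = weighted_stability_number V E w"
    using assms weighted_stability_number_attained unfolding finite_simple_graph_def by metis
  ultimately show "ereal (weighted_stability_number V E w) \<le> ereal l"
    using handelman_set_eval_nonneg[of "mconst l - stable_set_poly V E w u" V t S]
      eval_stable_set_poly[OF assms, of S w u] by (simp add: eval_monom_diff)
qed

text \<open>Each fractional edge packing within \<open>w\<close> gives a bound at level 2; the
  vertex cover enters only afterwards, to compare this bound with the stability number.\<close>

lemma edge_packing_certificate:
  assumes G: "finite_simple_graph V E"
    and u: "\<And>i j. {i, j} \<in> E \<Longrightarrow> u {i, j} \<ge> min (w i) (w j)"
    and y: "\<And>e. 0 \<le> y e" "\<And>i. i \<in> V \<Longrightarrow> (\<Sum>e\<in>{e\<in>E. i \<in> e}. y e) \<le> w i"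
  shows "mconst (sum w V - sum y E) - stable_set_poly V E w u \<in> handelman_set V 2"
proof -
  have "finite V" and E: "\<And>e. e \<in> E \<Longrightarrow> e \<subseteq> V \<and> card e = 2"
    using G by (auto simp: finite_simple_graph_def nsets_def)
  have "finite E"
    using E \<open>finite V\<close> by (intro finite_subset[of E "Pow V"]) blast+
  define z where "z i = w i - (\<Sum>e\<in>{e\<in>E. i \<in> e}. y e)" for i
  have y_le: "y e \<le> w i" if "e \<in> E" "i \<in> e" for e i
  proof -
    have "y e \<le> (\<Sum>e\<in>{e\<in>E. i \<in> e}. y e)"
      using that \<open>finite E\<close> y(1) by (intro member_le_sum) auto
    then show ?thesis
      using y(2)[of i] E that by fastforce
  qed
  \<comment> \<open>The condition on the edge weights enters here: \<open>y e\<close> is at most the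
    smaller end weight, hence at most \<open>u e\<close>.\<close>
  have y_u: "y e \<le> u e" if "e \<in> E" for e
  proof -
    obtain i j where "e = {i, j}"
      using E[OF \<open>e \<in> E\<close>] by (auto simp: card_2_iff)
    then show ?thesis
      using y_le[of e i] y_le[of e j] u[of i j] that by (auto simp: min_def split: if_splits)
  qed
  let ?P = "\<lambda>e. \<Prod>i\<in>e. mvar i" and ?Q = "\<lambda>e. \<Prod>i\<in>e. 1 - mvar i :: 'a real_mpoly"
  have Q: "?Q e = 1 - (\<Sum>i\<in>e. mvar i) + ?P e" if "e \<in> E" for e
    using E[OF that] by (auto simp: card_2_iff algebra_simps)
  have "(\<Sum>i\<in>V. mconst (\<Sum>e\<in>{e\<in>E. i \<in> e}. y e) * (1 - mvar i))
    = (\<Sum>i\<in>V. \<Sum>e\<in>{e\<in>E. i \<in> e}. mconst (y e) * (1 - mvar i))"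
    by (simp add: mconst_sum sum_distrib_right)
  \<comment> \<open>Double counting of incidences; the constant 2 below is the number of ends of an
    edge.\<close>
  also have "\<dots> = (\<Sum>e\<in>E. \<Sum>i\<in>{i\<in>V. i \<in> e}. mconst (y e) * (1 - mvar i))"
    using \<open>finite V\<close> \<open>finite E\<close> by (rule sum.swap_restrict)
  also have "\<dots> = (\<Sum>e\<in>E. mconst (y e) * (2 - (\<Sum>i\<in>e. mvar i)))"
  proof (rule sum.cong)
    fix e assume "e \<in> E"
    then have "{i\<in>V. i \<in> e} = e" "card e = 2"
      using E by auto
    then show "(\<Sum>i\<in>{i\<in>V. i \<in> e}. mconst (y e) * (1 - mvar i)) = mconst (y e) * (2 - (\<Sum>i\<in>e. mvar i))"
      by (simp add: sum_subtractf flip: sum_distrib_left)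
  qed simp
  finally have deg: "(\<Sum>i\<in>V. mconst (\<Sum>e\<in>{e\<in>E. i \<in> e}. y e) * (1 - mvar i))
    = (\<Sum>e\<in>E. mconst (y e) * (2 - (\<Sum>i\<in>e. mvar i)))" .
  have nodes: "(\<Sum>i\<in>V. mconst (z i) * (1 - mvar i)) = (\<Sum>i\<in>V. mconst (w i))
    - (\<Sum>i\<in>V. mconst (w i) * mvar i) - (\<Sum>e\<in>E. mconst (y e) * (2 - (\<Sum>i\<in>e. mvar i)))"
    unfolding deg[symmetric] sum_subtractf[symmetric]
    by (intro sum.cong) (simp_all add: z_def mconst_diff algebra_simps)
  have edges: "(\<Sum>e\<in>E. mconst (y e) * ?Q e)
    = (\<Sum>e\<in>E. mconst (y e) * (2 - (\<Sum>i\<in>e. mvar i))) - (\<Sum>e\<in>E. mconst (y e)) + (\<Sum>e\<in>E. mconst (y e) * ?P e)"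
    unfolding sum_subtractf[symmetric] sum.distrib[symmetric]
    by (intro sum.cong) (simp_all add: Q algebra_simps)
  \<comment> \<open>The terms \<open>mconst (y e) * (2 - (\<Sum>i\<in>e. mvar i))\<close> cancel
    between \<open>nodes\<close> and \<open>edges\<close>. The products
    \<open>mconst (y e) * ?P e\<close> left by \<open>edges\<close> are absorbed by the coefficient
    \<open>u e - y e\<close>.\<close>
  have "mconst (sum w V - sum y E) - stable_set_poly V E w u
    = (\<Sum>i\<in>V. mconst (z i) * (1 - mvar i)) + (\<Sum>e\<in>E. mconst (y e) * ?Q e)
      + (\<Sum>e\<in>E. mconst (u e - y e) * ?P e)"
    unfolding nodes edges
    by (simp add: stable_set_poly_def mconst_diff mconst_sum left_diff_distrib sum_subtractf)
  \<comment> \<open>The three kinds of generators come from \<open>T = {i}\<close> with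
    \<open>I = {}\<close>, then \<open>T = e\<close> with \<open>I = {}\<close>, and
    \<open>T = e\<close> with \<open>I = e\<close>.\<close>
  moreover have "mconst (z i) * (1 - mvar i) \<in> handelman_set V 2" if "i \<in> V" for i
    using handelman_set_generator[of V "{i}" 2 "{}" "z i"] \<open>finite V\<close> y(2)[OF that] that
    by (simp add: z_def)
  moreover have "mconst (y e) * ?Q e \<in> handelman_set V 2" if "e \<in> E" for e
    using handelman_set_generator[of V e 2 "{}" "y e"] \<open>finite V\<close> y(1)[of e] E[OF that]
    by simp
  moreover have "mconst (u e - y e) * ?P e \<in> handelman_set V 2" if "e \<in> E" for e
    using handelman_set_generator[of V e 2 e "u e - y e"] \<open>finite V\<close> y_u[OF that] E[OF that]
    by simp
  ultimately show ?thesis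
    by (simp add: handelman_set_add handelman_set_sum)
qed

theorem corollary3:
  fixes V :: "'a set" and E :: "'a set set"
    and w :: "'a \<Rightarrow> real" and u :: "'a set \<Rightarrow> real"
  assumes "finite_simple_graph V E"
    and "bipartite_graph V E"
    and "\<And>i. i \<in> V \<Longrightarrow> w i \<ge> 0"
    and "\<And>i j. {i, j} \<in> E \<Longrightarrow> u {i, j} \<ge> min (w i) (w j)"
  shows "handelman_rank V E w u \<le> 2"
proof -
  let ?\<alpha> = "weighted_stability_number V E w"
  have "finite V" "E \<subseteq> Pow V"
    using assms(1) by (auto simp: finite_simple_graph_def nsets_def)
  then have "finite E"
    by (auto intro: finite_subset)
  obtain A B where AB: "A \<union> B = V" "A \<inter> B = {}" and "\<forall>e\<in>E. \<exists>a\<in>A. \<exists>b\<in>B. e = {a, b}"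
    using assms(2) unfolding bipartite_graph_def by (elim exE conjE)
  note bip = bspec[OF this(3)]
  have "finite A" "finite B"
    using \<open>finite V\<close> AB(1) by auto
  from weighted_koenig[OF \<open>finite E\<close> this AB(2) bip, of w]
  have "\<exists>y C. (\<forall>e. 0 \<le> y e) \<and> (\<forall>i\<in>V. (\<Sum>e\<in>{e\<in>E. i \<in> e}. y e) \<le> w i) \<and>
    vertex_cover V E C \<and> sum w C \<le> sum y E"
    using assms(3) by (simp add: AB(1))
  then obtain y C where y: "\<And>e. 0 \<le> y e" "\<And>i. i \<in> V \<Longrightarrow> (\<Sum>e\<in>{e\<in>E. i \<in> e}. y e) \<le> w i"
    and C: "vertex_cover V E C" "sum w C \<le> sum y E"
    by blast
  \<comment> \<open>The complement of a vertex cover is stable, so w(V) - y(E) is at most w(V) -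
    w(C) = w(V - C), and hence at most the stability number.\<close>
  have "indep (V - C) E"
    using C(1) by (force simp: vertex_cover_def indep_def)
  then have "sum w (V - C) \<le> ?\<alpha>"
    using \<open>finite V\<close> by (intro weighted_stability_number_ge) auto
  moreover have "sum w V = sum w (V - C) + sum w C"
    using C(1) \<open>finite V\<close> by (intro sum.subset_diff) (auto simp: vertex_cover_def)
  ultimately have "sum w V - sum y E \<le> ?\<alpha>"
    using C(2) by simp
  moreover have "handelman_bound 2 V E w u \<le> ereal (sum w V - sum y E)"
    unfolding handelman_bound_def using edge_packing_certificate[OF assms(1,4) y]
    by (intro INF_lower) auto
  ultimately have "handelman_bound 2 V E w u \<le> ereal ?\<alpha>"
    by (meson ereal_less_eq(3) order_trans)
  then have "handelman_bound 2 V E w u = ereal ?\<alpha>"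
    using handelman_bound_ge[OF assms(1)] by (intro antisym)
  \<comment> \<open>The rank is an infimum over exact levels, so exactness at level 2 bounds
    it.\<close>
  then have "handelman_rank V E w u \<le> enat 2"
    unfolding handelman_rank_def by (intro Inf_lower) auto
  then show ?thesis
    by (simp add: numeral_eq_enat)
qed

end
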